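(* For a finite sequence of integers $A=(a_1,a_2,\dots,a_r)$ with $a_1\ge a_2\ge\cdots\ge a_r\ge2$, put $s_0=0$, $s_i=a_1+a_2+\cdots+a_i$, and $$\beta_A=(x_1x_2\cdots x_{s_1-1})(x_{s_1+1}\cdots x_{s_2-1})\cdots(x_{s_{r-1}+1}\cdots x_{s_r-1}).$$ (a) Every simple braid $\beta\in\mathcal{SB}_\infty$ is conjugate (in $\mathcal{B}_\infty$) to $\beta_A$ for some such sequence $A$. (b) If $A$ and $A'$ are two such sequences and $\beta_A$ is conjugate to $\beta_{A'}$, then $A=A'$.
   Context: $\mathcal{B}_n$ is Artin's braid group on $n$ strands, generated by $x_1,\dots,x_{n-1}$ with relations $x_ix_j=x_jx_i$ if $|i-j|\ge2$, $x_{i+1}x_ix_{i+1}=x_ix_{i+1}x_i$; $\mathcal{B}_n\subset\mathcal{B}_{n+1}$ by $x_i\mapsto x_i$, and $\mathcal{B}_\infty=\bigcup_n\mathcal{B}_n$. A braid in $\mathcal{B}_n$ is simple if it is represented by a positive word $x_{i_1}\cdots x_{i_k}$ with pairwise distinct indices; $\mathcal{SB}_n$ is the set of simple braids in $\mathcal{B}_n$ and $\mathcal{SB}_\infty=\bigcup_{n\ge1}\mathcal{SB}_n\subset\mathcal{B}_\infty$. The empty sequence $A$ ($r=0$) is allowed, with $\beta_A=1$. *)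

theory Defs
  imports "HOL-Algebra.Group"
begin

text \<open>A letter \<open>(i, True)\<close> stands for the generator \<open>x\<^sub>i\<close> and \<open>(i, False)\<close> for its inverse.\<close>

type_synonym braid_word = "(nat \<times> bool) list"

definition braid_words :: "nat \<Rightarrow> braid_word set" where
  "braid_words n = lists ({1..<n} \<times> UNIV)"

definition pos_word :: "nat list \<Rightarrow> braid_word" where
  "pos_word is = map (\<lambda>i. (i, True)) is"

text \<open>Equality in the group presented by Artin's generators and relations: the least congruence
  on the words of \<open>n\<close>-strand braids containing free cancellation and the braid relations.\<close>

inductive_set braid_eq :: "nat \<Rightarrow> braid_word rel" for n :: nat where
  refl: "w \<in> braid_words n \<Longrightarrow> (w, w) \<in> braid_eq n"
| sym: "(u, v) \<in> braid_eq n \<Longrightarrow> (v, u) \<in> braid_eq n"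
| trans: "(u, v) \<in> braid_eq n \<Longrightarrow> (v, w) \<in> braid_eq n \<Longrightarrow> (u, w) \<in> braid_eq n"
| cong: "(u, u') \<in> braid_eq n \<Longrightarrow> (v, v') \<in> braid_eq n \<Longrightarrow> (u @ v, u' @ v') \<in> braid_eq n"
| cancel: "i \<in> {1..<n} \<Longrightarrow> ([(i, b), (i, \<not> b)], []) \<in> braid_eq n"
| far: "i \<in> {1..<n} \<Longrightarrow> j \<in> {1..<n} \<Longrightarrow> 2 \<le> \<bar>int i - int j\<bar> \<Longrightarrow>
    (pos_word [i, j], pos_word [j, i]) \<in> braid_eq n"
| braid: "i \<in> {1..<n} \<Longrightarrow> i + 1 \<in> {1..<n} \<Longrightarrow>
    (pos_word [i + 1, i, i + 1], pos_word [i, i + 1, i]) \<in> braid_eq n"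

definition word_quotient :: "'a list set \<Rightarrow> 'a list rel \<Rightarrow> 'a list set monoid" where
  "word_quotient W E =
     \<lparr>carrier = W // E,
      monoid.mult = (\<lambda>X Y. E `` {u @ v | u v. u \<in> X \<and> v \<in> Y}),
      one = E `` {[]}\<rparr>"

definition braid_group :: "nat \<Rightarrow> braid_word set monoid" where
  "braid_group n = word_quotient (braid_words n) (braid_eq n)"

text \<open>The union of the groups \<open>braid_group n\<close> along the maps \<open>x\<^sub>i \<mapsto> x\<^sub>i\<close>, i.e. their direct limit:
  two words are identified as soon as they represent the same element of some \<open>braid_group n\<close>.\<close>

definition braid_eq_inf :: "braid_word rel" where
  "braid_eq_inf = (\<Union>n\<in>{1..}. braid_eq n)"

definition braid_group_inf :: "braid_word set monoid" where
  "braid_group_inf = word_quotient (\<Union>n\<in>{1..}. braid_words n) braid_eq_inf"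

text \<open>The maps \<open>x\<^sub>i \<mapsto> x\<^sub>i\<close> on classes of words, from \<open>braid_group n\<close> to \<open>braid_group m\<close> for \<open>n \<le> m\<close> and
  to \<open>braid_group_inf\<close>.\<close>

definition braid_incl :: "nat \<Rightarrow> braid_word set \<Rightarrow> braid_word set" where
  "braid_incl m X = braid_eq m `` X"

definition braid_incl_inf :: "braid_word set \<Rightarrow> braid_word set" where
  "braid_incl_inf X = braid_eq_inf `` X"

definition simple_braids :: "nat \<Rightarrow> braid_word set set" where
  "simple_braids n =
     {braid_eq n `` {pos_word is} | is. distinct is \<and> set is \<subseteq> {1..<n}}"

definition simple_braids_inf :: "braid_word set set" where
  "simple_braids_inf = (\<Union>n\<in>{1..}. braid_incl_inf ` simple_braids n)"

definition conjugate_in :: "('a, 'b) monoid_scheme \<Rightarrow> 'a \<Rightarrow> 'a \<Rightarrow> bool" where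
  "conjugate_in G x y \<longleftrightarrow>
     (\<exists>g\<in>carrier G. y = g \<otimes>\<^bsub>G\<^esub> x \<otimes>\<^bsub>G\<^esub> inv\<^bsub>G\<^esub> g)"

definition admissible :: "nat list \<Rightarrow> bool" where
  "admissible A \<longleftrightarrow> sorted_wrt (\<ge>) A \<and> (\<forall>a\<in>set A. 2 \<le> a)"

definition partial_sum :: "nat list \<Rightarrow> nat \<Rightarrow> nat" where
  "partial_sum A i = sum_list (take i A)"

text \<open>\<open>[s + 1..<t]\<close> is the list \<open>s + 1, \<dots>, t - 1\<close>.  Since lists are indexed from 0, block \<open>i\<close> below
  is the block of \<open>A ! i\<close>, running from \<open>s\<^sub>i + 1\<close> to \<open>s\<^sub>i\<^sub>+\<^sub>1 - 1\<close>.\<close>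

definition beta :: "nat list \<Rightarrow> braid_word set" where
  "beta A = braid_eq_inf ``
     {concat (map (\<lambda>i. pos_word [partial_sum A i + 1..<partial_sum A (i + 1)]) [0..<length A])}"

lemma beta_Nil: "beta [] = \<one>\<^bsub>braid_group_inf\<^esub>"
  by (simp add: beta_def braid_group_inf_def word_quotient_def)

text \<open>The constructions above are indeed groups and homomorphisms.\<close>

lemma braid_eq_words:
  assumes "(u, v) \<in> braid_eq n"
  shows "u \<in> braid_words n" "v \<in> braid_words n"
  using assms by (induction) (auto simp: braid_words_def pos_word_def)

lemma equiv_braid_eq: "equiv (braid_words n) (braid_eq n)"
  by (rule equivI)
    (auto simp: refl_on_def sym_def trans_def
      intro: braid_eq.refl braid_eq.sym braid_eq.trans dest: braid_eq_words)

lemma braid_words_mono: "n \<le> m \<Longrightarrow> braid_words n \<subseteq> braid_words m"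
  unfolding braid_words_def by (intro lists_mono) auto

lemma braid_eq_mono: "n \<le> m \<Longrightarrow> braid_eq n \<subseteq> braid_eq m"
proof
  fix p assume "n \<le> m" "p \<in> braid_eq n"
  then show "p \<in> braid_eq m"
  proof (induction p)
    case (Pair u v)
    from Pair(2) have "(u, v) \<in> braid_eq m"
    proof induction
      case (refl w)
      then show ?case using braid_words_mono[OF Pair(1)] by (blast intro: braid_eq.refl)
    next
      case (sym u v)
      then show ?case by (blast intro: braid_eq.sym)
    next
      case (trans u v w)
      show ?case by (rule braid_eq.trans[OF trans.IH])
    next
      case (cong u u' v v')
      show ?case by (rule braid_eq.cong[OF cong.IH])
    next
      case (cancel i b)
      then show ?case using Pair(1) by (intro braid_eq.cancel) auto
    next
      case (far i j)
      then show ?case using Pair(1) by (intro braid_eq.far) auto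
    next
      case (braid i)
      then show ?case using Pair(1) by (intro braid_eq.braid) auto
    qed
    then show ?case .
  qed
qed

lemma braid_inverse_word:
  assumes "w \<in> braid_words n"
  obtains w' where "w' \<in> braid_words n" "(w' @ w, []) \<in> braid_eq n"
proof -
  from assms have "\<exists>w'\<in>braid_words n. (w' @ w, []) \<in> braid_eq n"
  proof (induction w)
    case Nil
    then show ?case by (force intro: braid_eq.refl)
  next
    case (Cons a w)
    then obtain w' where w': "w' \<in> braid_words n" "(w' @ w, []) \<in> braid_eq n"
      by (auto simp: braid_words_def)
    obtain i b where a: "a = (i, b)" by (cases a)
    have i: "i \<in> {1..<n}" using Cons.prems a by (auto simp: braid_words_def)
    have w: "w \<in> braid_words n" using Cons.prems by (auto simp: braid_words_def)
    have "([(i, \<not> b), (i, b)], []) \<in> braid_eq n"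
      using braid_eq.cancel[OF i, of "\<not> b"] by simp
    then have "([(i, \<not> b), (i, b)] @ w, [] @ w) \<in> braid_eq n"
      using w by (intro braid_eq.cong braid_eq.refl)
    then have "(w' @ ([(i, \<not> b), (i, b)] @ w), w' @ ([] @ w)) \<in> braid_eq n"
      using w' by (intro braid_eq.cong[of w' w']) (auto intro: braid_eq.refl)
    then have "((w' @ [(i, \<not> b)]) @ a # w, []) \<in> braid_eq n"
      using w' a by (auto intro: braid_eq.trans)
    moreover have "w' @ [(i, \<not> b)] \<in> braid_words n"
      using w' i by (auto simp: braid_words_def)
    ultimately show ?case by blast
  qed
  then show thesis using that by blast
qed

locale word_congruence =
  fixes W :: "'a list set" and E :: "'a list rel"
  assumes equiv: "equiv W E"
    and nil: "[] \<in> W"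
    and append: "(u, u') \<in> E \<Longrightarrow> (v, v') \<in> E \<Longrightarrow> (u @ v, u' @ v') \<in> E"
    and left_inverse: "w \<in> W \<Longrightarrow> \<exists>w'\<in>W. (w' @ w, []) \<in> E"
begin

lemma words: "(u, v) \<in> E \<Longrightarrow> u \<in> W" "(u, v) \<in> E \<Longrightarrow> v \<in> W"
  using equiv by (auto simp: equiv_def)

lemma refl: "w \<in> W \<Longrightarrow> (w, w) \<in> E"
  using equiv by (auto simp: equiv_def refl_on_def)

lemma append_words: "u \<in> W \<Longrightarrow> v \<in> W \<Longrightarrow> u @ v \<in> W"
  using append[OF refl refl] words by blast

lemma mult_class:
  assumes "u \<in> W" "v \<in> W"
  shows "E `` {u} \<otimes>\<^bsub>word_quotient W E\<^esub> E `` {v} = E `` {u @ v}"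
proof -
  have t: "(a, c) \<in> E" if "(a, b) \<in> E" "(b, c) \<in> E" for a b c
    using equiv that by (meson equiv_def transD)
  have "({x @ y | x y. x \<in> E `` {u} \<and> y \<in> E `` {v}}) \<subseteq> E `` {u @ v}"
    by (auto intro: append)
  moreover have "u @ v \<in> {x @ y | x y. x \<in> E `` {u} \<and> y \<in> E `` {v}}"
    using assms refl by blast
  ultimately have "E `` {x @ y | x y. x \<in> E `` {u} \<and> y \<in> E `` {v}} = E `` {u @ v}"
    by (blast intro: t)
  then show ?thesis by (simp add: word_quotient_def)
qed

lemma carrierE:
  assumes "X \<in> carrier (word_quotient W E)"
  obtains u where "u \<in> W" "X = E `` {u}"
  using assms by (auto simp: word_quotient_def elim: quotientE)

lemma class_carrier: "u \<in> W \<Longrightarrow> E `` {u} \<in> carrier (word_quotient W E)"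
  by (auto simp: word_quotient_def intro: quotientI)

lemma one_class: "\<one>\<^bsub>word_quotient W E\<^esub> = E `` {[]}"
  by (simp add: word_quotient_def)

lemma group: "group (word_quotient W E)"
proof (rule groupI)
  show "X \<otimes>\<^bsub>word_quotient W E\<^esub> Y \<in> carrier (word_quotient W E)"
    if "X \<in> carrier (word_quotient W E)" "Y \<in> carrier (word_quotient W E)" for X Y
    using that by (auto elim!: carrierE simp: mult_class intro!: class_carrier append_words)
  show "\<one>\<^bsub>word_quotient W E\<^esub> \<in> carrier (word_quotient W E)"
    by (simp add: one_class class_carrier nil)
  show "X \<otimes>\<^bsub>word_quotient W E\<^esub> Y \<otimes>\<^bsub>word_quotient W E\<^esub> Z =
        X \<otimes>\<^bsub>word_quotient W E\<^esub> (Y \<otimes>\<^bsub>word_quotient W E\<^esub> Z)"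
    if "X \<in> carrier (word_quotient W E)" "Y \<in> carrier (word_quotient W E)"
      "Z \<in> carrier (word_quotient W E)" for X Y Z
    using that by (auto elim!: carrierE simp: mult_class append_words)
  show "\<one>\<^bsub>word_quotient W E\<^esub> \<otimes>\<^bsub>word_quotient W E\<^esub> X = X"
    if "X \<in> carrier (word_quotient W E)" for X
    using that by (auto elim!: carrierE simp: mult_class one_class nil)
  show "\<exists>Y\<in>carrier (word_quotient W E). Y \<otimes>\<^bsub>word_quotient W E\<^esub> X = \<one>\<^bsub>word_quotient W E\<^esub>"
    if X: "X \<in> carrier (word_quotient W E)" for X
  proof -
    obtain u where u: "u \<in> W" "X = E `` {u}" using X by (rule carrierE)
    obtain u' where u': "u' \<in> W" "(u' @ u, []) \<in> E" using left_inverse u by blast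
    have "E `` {u'} \<otimes>\<^bsub>word_quotient W E\<^esub> X = \<one>\<^bsub>word_quotient W E\<^esub>"
      using u u' equiv by (simp add: mult_class one_class equiv_class_eq)
    then show ?thesis using class_carrier u' by blast
  qed
qed

end

lemma word_congruence_braid: "word_congruence (braid_words n) (braid_eq n)"
proof
  show "\<exists>w'\<in>braid_words n. (w' @ w, []) \<in> braid_eq n" if "w \<in> braid_words n" for w
    using that braid_inverse_word by blast
qed (auto simp: equiv_braid_eq braid_eq.cong, simp add: braid_words_def)

lemma group_braid_group: "group (braid_group n)"
  unfolding braid_group_def using word_congruence_braid by (rule word_congruence.group)

lemma word_congruence_braid_inf:
  "word_congruence (\<Union>n\<in>{1..}. braid_words n) braid_eq_inf"
proof
  have up: "(u, v) \<in> braid_eq (max k l)" if "(u, v) \<in> braid_eq k \<or> (u, v) \<in> braid_eq l" for u v k l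
    using that braid_eq_mono[of k "max k l"] braid_eq_mono[of l "max k l"] by auto
  have max1: "max k l \<in> {1..}" if "k \<in> {1..}" for k l :: nat using that by auto
  show "equiv (\<Union>n\<in>{1..}. braid_words n) braid_eq_inf"
  proof (rule equivI)
    show "braid_eq_inf \<subseteq> (\<Union>n\<in>{1..}. braid_words n) \<times> (\<Union>n\<in>{1..}. braid_words n)"
      by (force simp: braid_eq_inf_def dest: braid_eq_words)
    show "refl_on (\<Union>n\<in>{1..}. braid_words n) braid_eq_inf"
      by (force simp: refl_on_def braid_eq_inf_def intro: braid_eq.refl)
    show "sym braid_eq_inf"
      by (auto simp: sym_def braid_eq_inf_def intro: braid_eq.sym)
    show "trans braid_eq_inf"
    proof (rule transI)
      fix u v w assume "(u, v) \<in> braid_eq_inf" "(v, w) \<in> braid_eq_inf"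
      then obtain k l where "k \<in> {1..}" "(u, v) \<in> braid_eq k" "(v, w) \<in> braid_eq l"
        by (auto simp: braid_eq_inf_def)
      then show "(u, w) \<in> braid_eq_inf"
        unfolding braid_eq_inf_def using up braid_eq.trans max1 by (meson UN_iff)
    qed
  qed
  show "[] \<in> (\<Union>n\<in>{1..}. braid_words n)"
    by (auto simp: braid_words_def)
  show "(u @ v, u' @ v') \<in> braid_eq_inf"
    if uv: "(u, u') \<in> braid_eq_inf" "(v, v') \<in> braid_eq_inf" for u u' v v'
  proof -
    from uv obtain k l where "k \<in> {1..}" "(u, u') \<in> braid_eq k" "(v, v') \<in> braid_eq l"
      by (auto simp: braid_eq_inf_def)
    then show ?thesis
      unfolding braid_eq_inf_def using up braid_eq.cong max1 by (meson UN_iff)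
  qed
  show "\<exists>w'\<in>\<Union>n\<in>{1..}. braid_words n. (w' @ w, []) \<in> braid_eq_inf"
    if "w \<in> (\<Union>n\<in>{1..}. braid_words n)" for w
    using that unfolding braid_eq_inf_def by (metis UN_iff braid_inverse_word)
qed

lemma group_braid_group_inf: "group braid_group_inf"
  unfolding braid_group_inf_def using word_congruence_braid_inf by (rule word_congruence.group)

lemma word_incl_hom:
  assumes "word_congruence W E" "word_congruence W' E'" "W \<subseteq> W'" "E \<subseteq> E'"
  shows "(\<lambda>X. E' `` X) \<in> hom (word_quotient W E) (word_quotient W' E')"
    and "\<And>w. w \<in> W \<Longrightarrow> E' `` (E `` {w}) = E' `` {w}"
proof -
  interpret A: word_congruence W E by fact
  interpret B: word_congruence W' E' by fact
  show *: "E' `` (E `` {w}) = E' `` {w}" if w: "w \<in> W" for w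
    using A.refl[OF w] assms(4) B.equiv by (auto simp: equiv_def dest: transD)
  show "(\<lambda>X. E' `` X) \<in> hom (word_quotient W E) (word_quotient W' E')"
    using assms(3)
    by (intro homI; elim A.carrierE)
      (auto simp: * A.mult_class B.mult_class A.append_words subset_iff intro: B.class_carrier)
qed

lemma braid_incl_hom:
  assumes "n \<le> m"
  shows "braid_incl m \<in> hom (braid_group n) (braid_group m)"
    and "w \<in> braid_words n \<Longrightarrow> braid_incl m (braid_eq n `` {w}) = braid_eq m `` {w}"
  using word_incl_hom[OF word_congruence_braid word_congruence_braid
      braid_words_mono[OF assms] braid_eq_mono[OF assms]]
  by (auto simp: braid_group_def braid_incl_def[abs_def])

lemma braid_incl_inf_hom:
  assumes "1 \<le> n"
  shows "braid_incl_inf \<in> hom (braid_group n) braid_group_inf"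
    and "w \<in> braid_words n \<Longrightarrow> braid_incl_inf (braid_eq n `` {w}) = braid_eq_inf `` {w}"
proof -
  have "braid_words n \<subseteq> (\<Union>n\<in>{1..}. braid_words n)" "braid_eq n \<subseteq> braid_eq_inf"
    using assms by (auto simp: braid_eq_inf_def)
  from word_incl_hom[OF word_congruence_braid word_congruence_braid_inf this]
  show "braid_incl_inf \<in> hom (braid_group n) braid_group_inf"
    and "w \<in> braid_words n \<Longrightarrow> braid_incl_inf (braid_eq n `` {w}) = braid_eq_inf `` {w}"
    by (auto simp: braid_group_def braid_group_inf_def braid_incl_inf_def[abs_def])
qed

lemma carrier_braid_group_inf:
  "carrier braid_group_inf = (\<Union>n\<in>{1..}. braid_incl_inf ` carrier (braid_group n))"
proof (intro equalityI subsetI)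
  fix X assume "X \<in> carrier braid_group_inf"
  then obtain w n where "1 \<le> n" "w \<in> braid_words n" "X = braid_eq_inf `` {w}"
    unfolding braid_group_inf_def
    by (elim word_congruence.carrierE[OF word_congruence_braid_inf]) auto
  then have "X = braid_incl_inf (braid_eq n `` {w})" "braid_eq n `` {w} \<in> carrier (braid_group n)"
    using braid_incl_inf_hom(2) word_congruence.class_carrier[OF word_congruence_braid]
    by (auto simp: braid_group_def)
  then show "X \<in> (\<Union>n\<in>{1..}. braid_incl_inf ` carrier (braid_group n))"
    using \<open>1 \<le> n\<close> by blast
next
  fix X assume "X \<in> (\<Union>n\<in>{1..}. braid_incl_inf ` carrier (braid_group n))"
  then show "X \<in> carrier braid_group_inf"
    using braid_incl_inf_hom(1) by (auto simp: hom_def)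
qed

lemma simple_braids_carrier: "simple_braids n \<subseteq> carrier (braid_group n)"
proof
  fix X assume "X \<in> simple_braids n"
  then obtain xs where "set xs \<subseteq> {1..<n}" "X = braid_eq n `` {pos_word xs}"
    by (auto simp: simple_braids_def)
  moreover from this have "pos_word xs \<in> braid_words n"
    by (auto simp: braid_words_def pos_word_def)
  ultimately show "X \<in> carrier (braid_group n)"
    using word_congruence.class_carrier[OF word_congruence_braid] by (simp add: braid_group_def)
qed

end

theory Submission
  imports Defs "HOL-Library.Multiset" "HOL-Combinatorics.Orbits"
begin

text \<open>
  Conjugacy to some \<open>\<beta>\<^sub>A\<close> only needs positive braids.  Rotating a word and commuting distant letters
  sorts a word with distinct letters, and a sorted word is a product of blocks of consecutive letters.
  If \<open>\<delta>\<close> is the product of the generators on \<open>p + q\<close> consecutive strands, then conjugation by \<open>\<delta>\<close>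
  rotates these generators cyclically, so \<open>\<delta>\<^sup>q\<close> exchanges adjacent blocks on \<open>p\<close> and \<open>q\<close> strands.
  Conversely, the parts of \<open>A\<close> are the sizes of the nontrivial orbits of the permutation underlying
  \<open>\<beta>\<^sub>A\<close>.
\<close>

section \<open>The Artin monoid\<close>

text \<open>Positive words on generators indexed from \<open>0\<close>: the letter \<open>i\<close> stands for \<open>x\<^sub>i\<^sub>+\<^sub>1\<close>.\<close>

inductive artin_eq :: "nat list \<Rightarrow> nat list \<Rightarrow> bool" where
  refl: "artin_eq u u"
| sym: "artin_eq u v \<Longrightarrow> artin_eq v u"
| trans: "artin_eq u v \<Longrightarrow> artin_eq v w \<Longrightarrow> artin_eq u w"
| append: "artin_eq u u' \<Longrightarrow> artin_eq v v' \<Longrightarrow> artin_eq (u @ v) (u' @ v')"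
| far: "i + 2 \<le> j \<Longrightarrow> artin_eq [i, j] [j, i]"
| braid: "artin_eq [Suc i, i, Suc i] [i, Suc i, i]"

\<comment> \<open>As an instance of \<open>monoid_mult\<close>, the quotient turns manipulations of
  words into algebra with powers and associativity.\<close>
quotient_type artin_monoid = "nat list" / artin_eq
  by (intro equivpI reflpI sympI transpI) (fact artin_eq.refl, erule artin_eq.sym, erule (1) artin_eq.trans)

instantiation artin_monoid :: monoid_mult
begin

lift_definition one_artin_monoid :: artin_monoid is "[]" .

lift_definition times_artin_monoid :: "artin_monoid \<Rightarrow> artin_monoid \<Rightarrow> artin_monoid" is "(@)"
  by (rule artin_eq.append)

instance
  by standard (transfer, simp add: artin_eq.refl)+

end

lift_definition gen :: "nat \<Rightarrow> artin_monoid" is "\<lambda>i. [i]" .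

definition word :: "nat list \<Rightarrow> artin_monoid" where
  "word w = prod_list (map gen w)"

lemma word_simps [simp]:
  "word [] = 1" "word (i # w) = gen i * word w" "word (u @ v) = word u * word v"
  by (simp_all add: word_def)

lemma word_eq_abs: "word w = abs_artin_monoid w"
proof (induction w)
  case Nil
  then show ?case by (simp add: one_artin_monoid_def)
next
  case (Cons i w)
  then show ?case by (simp add: gen.abs_eq times_artin_monoid.abs_eq)
qed

lemma word_eq_iff: "word u = word v \<longleftrightarrow> artin_eq u v"
  by (simp add: word_eq_abs artin_monoid.abs_eq_iff)

lemma obtain_word:
  obtains w where "g = word w"
  by (metis word_eq_abs Quotient3_abs_rep Quotient3_artin_monoid)

lemma gen_far:
  assumes "i + 2 \<le> j \<or> j + 2 \<le> i"
  shows "gen i * gen j = gen j * gen i"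
proof -
  have "artin_eq [i, j] [j, i]" using assms artin_eq.far artin_eq.sym by blast
  then show ?thesis using word_eq_iff[of "[i, j]" "[j, i]"] by simp
qed

lemma gen_braid: "gen (Suc i) * (gen i * gen (Suc i)) = gen i * (gen (Suc i) * gen i)"
  using word_eq_iff[of "[Suc i, i, Suc i]" "[i, Suc i, i]"] by (simp add: artin_eq.braid)

text \<open>Taking \<open>f\<close> to be the identity gives commutation; taking it to be a shift
  describes conjugation by powers of \<delta>.\<close>

lemma word_intertwine:
  assumes "\<And>i. i \<in> set w \<Longrightarrow> g * gen i = gen (f i) * g"
  shows "g * word w = word (map f w) * g"
  using assms
proof (induction w)
  case Nil
  then show ?case by simp
next
  case (Cons i w)
  have "g * word (i # w) = (g * gen i) * word w" by (simp add: mult.assoc)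
  also have "\<dots> = gen (f i) * (g * word w)" using Cons.prems by (simp add: mult.assoc)
  also have "\<dots> = word (map f (i # w)) * g" using Cons by (simp add: mult.assoc)
  finally show ?case .
qed

lemma gen_word_far:
  assumes "\<And>i. i \<in> set w \<Longrightarrow> i + 2 \<le> j \<or> j + 2 \<le> i"
  shows "gen j * word w = word w * gen j"
proof -
  have "gen j * word w = word (map (\<lambda>i. i) w) * gen j"
    by (rule word_intertwine, rule gen_far) (use assms in blast)
  then show ?thesis by simp
qed

lemma word_word_far:
  assumes "\<And>i j. i \<in> set u \<Longrightarrow> j \<in> set v \<Longrightarrow> i + 2 \<le> j \<or> j + 2 \<le> i"
  shows "word u * word v = word v * word u"
proof -
  have "word u * word v = word (map (\<lambda>j. j) v) * word u"
    by (rule word_intertwine, rule gen_word_far[symmetric]) (use assms in blast)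
  then show ?thesis by simp
qed

text \<open>In a group this is conjugacy; in the monoid the relation is not obviously symmetric.\<close>

definition intertwined :: "artin_monoid \<Rightarrow> artin_monoid \<Rightarrow> bool" where
  "intertwined a b \<longleftrightarrow> (\<exists>g. g * a = b * g)"

lemma intertwined_refl: "intertwined a a"
  unfolding intertwined_def by (rule exI[of _ 1]) simp

lemma intertwined_trans:
  assumes "intertwined a b" "intertwined b c"
  shows "intertwined a c"
proof -
  obtain g h where gh: "g * a = b * g" "h * b = c * h"
    using assms by (auto simp: intertwined_def)
  have "(h * g) * a = h * (b * g)" using gh by (simp add: mult.assoc)
  also have "\<dots> = c * (h * g)" using gh by (simp flip: mult.assoc)
  finally show ?thesis unfolding intertwined_def by blast
qed

section \<open>Sorting words with distinct letters\<close>

text \<open>Both moves keep the multiset of letters, so distinctness survives; rotating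
  \<open>u @ v\<close> is conjugation by \<open>v\<close>.\<close>

inductive rotate_commute :: "nat list \<Rightarrow> nat list \<Rightarrow> bool" where
  rotate: "rotate_commute (u @ v) (v @ u)"
| commute: "i + 2 \<le> j \<or> j + 2 \<le> i \<Longrightarrow> rotate_commute (u @ [i, j] @ v) (u @ [j, i] @ v)"
| trans: "rotate_commute u v \<Longrightarrow> rotate_commute v w \<Longrightarrow> rotate_commute u w"

lemma rotate_commute_refl: "rotate_commute u u"
  using rotate_commute.rotate[of "[]" u] by simp

lemma rotate_commute_mset: "rotate_commute u v \<Longrightarrow> mset u = mset v"
  by (induction rule: rotate_commute.induct) auto

lemma rotate_commute_intertwined: "rotate_commute u v \<Longrightarrow> intertwined (word u) (word v)"
proof (induction rule: rotate_commute.induct)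
  case (rotate u v)
  show ?case unfolding intertwined_def by (rule exI[of _ "word v"]) (simp add: mult.assoc)
next
  case (commute i j u v)
  have "word (u @ [i, j] @ v) = word u * (gen i * gen j) * word v" by (simp add: mult.assoc)
  also have "\<dots> = word u * (gen j * gen i) * word v" by (simp only: gen_far[OF commute])
  also have "\<dots> = word (u @ [j, i] @ v)" by (simp add: mult.assoc)
  finally show ?case by (metis intertwined_refl)
next
  case (trans u v w)
  then show ?case by (blast intro: intertwined_trans)
qed

lemma rotate_commute_move_right:
  assumes "\<And>i. i \<in> set v \<Longrightarrow> i + 2 \<le> m \<or> m + 2 \<le> i"
  shows "rotate_commute (u @ [m] @ v @ w) (u @ v @ [m] @ w)"
  using assms
proof (induction v arbitrary: u)
  case Nil
  then show ?case by (simp add: rotate_commute_refl)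
next
  case (Cons i v)
  have "rotate_commute (u @ [m, i] @ v @ w) (u @ [i, m] @ v @ w)"
    using Cons.prems by (intro rotate_commute.commute) auto
  moreover have "rotate_commute ((u @ [i]) @ [m] @ v @ w) ((u @ [i]) @ v @ [m] @ w)"
    by (rule Cons.IH) (use Cons.prems in auto)
  ultimately show ?case by (auto intro: rotate_commute.trans)
qed

lemma rotate_commute_move_left:
  assumes "\<And>i. i \<in> set v \<Longrightarrow> i + 2 \<le> m \<or> m + 2 \<le> i"
  shows "rotate_commute (u @ v @ [m] @ w) (u @ [m] @ v @ w)"
  using assms
proof (induction v arbitrary: u)
  case Nil
  then show ?case by (simp add: rotate_commute_refl)
next
  case (Cons i v)
  have "rotate_commute ((u @ [i]) @ v @ [m] @ w) ((u @ [i]) @ [m] @ v @ w)"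
    by (rule Cons.IH) (use Cons.prems in auto)
  moreover have "rotate_commute (u @ [i, m] @ v @ w) (u @ [m, i] @ v @ w)"
    using Cons.prems by (intro rotate_commute.commute) auto
  ultimately show ?case by (auto intro: rotate_commute.trans)
qed

text \<open>In a rotation of \<open>u @ v\<close>, the letter \<open>m - 1\<close> is missing in \<open>u\<close> or in \<open>v\<close>, and that part
  commutes with \<open>m\<close>.\<close>

lemma rotate_commute_snoc:
  assumes "rotate_commute u v" "distinct u" "\<forall>i\<in>set u. i < m"
  shows "rotate_commute (u @ [m]) (v @ [m])"
  using assms
proof (induction rule: rotate_commute.induct)
  case (rotate u v)
  have far: "i + 2 \<le> m \<or> m + 2 \<le> i" if "m - 1 \<notin> set w" "i \<in> set w" "w = u \<or> w = v" for i w
  proof -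
    have "i < m" "i \<noteq> m - 1" using that rotate by auto
    then show ?thesis by linarith
  qed
  consider "m - 1 \<notin> set v" | "m - 1 \<notin> set u" using rotate by auto
  then show ?case
  proof cases
    case 1
    have "rotate_commute (u @ v @ [m] @ []) (u @ [m] @ v @ [])"
      by (rule rotate_commute_move_left) (use far 1 in auto)
    moreover have "rotate_commute ((u @ [m]) @ v) (v @ u @ [m])"
      by (rule rotate_commute.rotate)
    ultimately show ?thesis by (auto intro: rotate_commute.trans)
  next
    case 2
    have "rotate_commute (u @ v @ [m]) ((v @ [m]) @ u)"
      by (rule rotate_commute.rotate)
    moreover have "rotate_commute (v @ [m] @ u @ []) (v @ u @ [m] @ [])"
      by (rule rotate_commute_move_right) (use far 2 in auto)
    ultimately show ?thesis by (auto intro: rotate_commute.trans)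
  qed
next
  case (commute i j u v)
  then show ?case using rotate_commute.commute[of i j u "v @ [m]"] by simp
next
  case (trans u v w)
  have "mset u = mset v" using trans.hyps(1) by (rule rotate_commute_mset)
  then have "distinct v" "set v = set u"
    using trans.prems by (metis mset_eq_imp_distinct_iff, metis mset_eq_setD)
  then show ?case using trans by (auto intro: rotate_commute.trans)
qed

text \<open>Rotation brings the largest letter \<open>m\<close> to the end. The shorter word in
  front of it is sorted by induction, and \<open>rotate_commute_snoc\<close> lets this happen in the
  presence of \<open>m\<close>.\<close>

lemma rotate_commute_sort:
  assumes "distinct w"
  shows "\<exists>w'. rotate_commute w w' \<and> sorted_wrt (<) w'"
  using assms
proof (induction "length w" arbitrary: w)
  case 0
  then show ?case using rotate_commute_refl by force
next
  case (Suc n)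
  define m where "m = Max (set w)"
  have "m \<in> set w" unfolding m_def using Suc.hyps(2) by (intro Max_in) auto
  then obtain u v where w: "w = u @ m # v" by (meson split_list)
  have lt: "\<forall>i\<in>set (v @ u). i < m"
  proof
    fix i assume i: "i \<in> set (v @ u)"
    then have "i \<in> set w" using w by auto
    then have "i \<le> m" unfolding m_def by (intro Max_ge) auto
    moreover have "i \<noteq> m" using i Suc.prems w by auto
    ultimately show "i < m" by simp
  qed
  have dist: "distinct (v @ u)" using Suc.prems w by auto
  have "n = length (v @ u)" using Suc.hyps(2) w by simp
  from Suc.hyps(1)[OF this dist] obtain w' where w': "rotate_commute (v @ u) w'" "sorted_wrt (<) w'"
    by blast
  have "rotate_commute ((u @ [m]) @ v) (v @ u @ [m])" by (rule rotate_commute.rotate)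
  moreover have "rotate_commute ((v @ u) @ [m]) (w' @ [m])"
    using w' dist lt by (intro rotate_commute_snoc)
  ultimately have "rotate_commute w (w' @ [m])" using w by (auto intro: rotate_commute.trans)
  moreover have "set w' = set (v @ u)" using rotate_commute_mset[OF w'(1)] by (metis mset_eq_setD)
  ultimately show ?case using w' lt by (intro exI[of _ "w' @ [m]"]) (auto simp: sorted_wrt_append)
qed

section \<open>Blocks of consecutive letters\<close>

text \<open>A part \<open>p\<close> occupies \<open>p\<close> strands and contributes
  \<open>p - 1\<close> generators. Thus a part 1 only skips a strand, and a part 0 changes
  nothing.\<close>

fun blocks :: "nat \<Rightarrow> nat list \<Rightarrow> nat list" where
  "blocks s [] = []"
| "blocks s (p # c) = [s..<s + p - 1] @ blocks (s + p) c"

lemma blocks_append: "blocks s (c @ d) = blocks s c @ blocks (s + sum_list c) d"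
  by (induction c arbitrary: s) (simp_all add: add.assoc)

text \<open>Generator \<open>i\<close> joins strands \<open>i\<close> and \<open>i + 1\<close>, and
  the last strand is \<open>s + sum_list c - 1\<close>. The resulting offset 2 makes letters of
  different blocks commute.\<close>

lemma blocks_bounds: "i \<in> set (blocks s c) \<Longrightarrow> s \<le> i \<and> i + 2 \<le> s + sum_list c"
  by (induction c arbitrary: s) fastforce+

lemma blocks_trivial: "\<forall>a\<in>set c. a < 2 \<Longrightarrow> blocks s c = []"
  by (induction c arbitrary: s) auto

lemma map_Suc_blocks: "map Suc (blocks s c) = blocks (Suc s) c"
proof (induction c arbitrary: s)
  case (Cons p c)
  \<comment> \<open>For \<open>p = 0\<close> the truncated bound \<open>s + p - 1\<close> need not
    commute with \<open>Suc\<close>, but both intervals are empty.\<close>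
  then show ?case by (cases p) (simp_all add: map_Suc_upt)
qed simp

text \<open>The tail is cut into blocks starting at \<open>Suc i\<close>; prepending
  \<open>i\<close> enlarges the first part \<open>p\<close> to \<open>Suc p\<close>. This fails for
  \<open>p = 0\<close>, whence the second conjunct.\<close>

lemma sorted_eq_blocks:
  assumes "sorted_wrt (<) w" "\<forall>i\<in>set w. s \<le> i"
  shows "\<exists>c. w = blocks s c \<and> 0 \<notin> set c"
  using assms
proof (induction w arbitrary: s)
  case Nil
  have "[] = blocks s [] \<and> 0 \<notin> set ([] :: nat list)" by simp
  then show ?case by blast
next
  case (Cons i w)
  then have "\<exists>c. w = blocks (Suc i) c \<and> 0 \<notin> set c" by (intro Cons.IH) auto
  then obtain c where c: "w = blocks (Suc i) c" "0 \<notin> set c" by blast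
  have "\<exists>d. i # w = blocks i d \<and> 0 \<notin> set d"
  proof (cases c)
    case Nil
    then have "i # w = blocks i [2] \<and> 0 \<notin> set [2 :: nat]" using c by simp
    then show ?thesis by blast
  next
    case (Cons p c')
    then have "i # w = blocks i (Suc p # c') \<and> 0 \<notin> set (Suc p # c')"
      using c by (simp add: upt_conv_Cons)
    then show ?thesis by blast
  qed
  then obtain d where d: "i # w = blocks i d" "0 \<notin> set d" by blast
  \<comment> \<open>Parts 1 skip the strands from \<open>s\<close> up to \<open>i\<close>.\<close>
  have "blocks s (replicate (i - s) 1 @ d) = blocks i d"
    using Cons.prems by (simp add: blocks_append blocks_trivial sum_list_replicate)
  moreover have "0 \<notin> set (replicate (i - s) 1 @ d)" using d by auto
  ultimately show ?case using d by metis
qed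

section \<open>Conjugation by a product of consecutive generators\<close>

lemma coxeter_shift:
  assumes "s \<le> i" "Suc i < t"
  shows "word [s..<t] * gen i = gen (Suc i) * word [s..<t]"
proof -
  let ?u = "word [s..<i]" and ?v = "word [i + 2..<t]"
  have "[s..<t] = [s..<i] @ [i..<t]"
    using assms upt_add_eq_append[of s i "t - i"] by simp
  then have split: "word [s..<t] = ?u * (gen i * (gen (Suc i) * ?v))"
    using assms by (simp add: upt_conv_Cons)
  have u: "gen (Suc i) * ?u = ?u * gen (Suc i)" by (rule gen_word_far) auto
  have v: "gen i * ?v = ?v * gen i" by (rule gen_word_far) auto
  \<comment> \<open>\<open>gen i\<close> slides left past the letters above \<open>Suc i\<close>,
    the braid relation turns it into \<open>gen (Suc i)\<close>, and this slides left past the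
    letters below \<open>i\<close>.\<close>
  have "word [s..<t] * gen i = ?u * (gen i * (gen (Suc i) * gen i)) * ?v"
    using v by (simp add: split mult.assoc)
  also have "\<dots> = (?u * gen (Suc i)) * (gen i * (gen (Suc i) * ?v))"
    by (simp add: mult.assoc flip: gen_braid)
  also have "\<dots> = gen (Suc i) * word [s..<t]"
    by (simp add: split mult.assoc flip: u)
  finally show ?thesis .
qed

text \<open>Write \<open>?d\<close> as \<open>gen s * r\<close> and as \<open>l * gen t\<close>.
  Shifting gives \<open>?d * l = r * ?d\<close>, hence
  \<open>gen s * ?d * l * gen t = gen s * r * ?d * gen t\<close>, which is the claim.\<close>

lemma coxeter_wrap:
  assumes "s \<le> t"
  shows "word [s..<Suc t] ^ 2 * gen t = gen s * word [s..<Suc t] ^ 2"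
proof -
  let ?d = "word [s..<Suc t]"
  have first: "?d = gen s * word [Suc s..<Suc t]" using assms by (subst upt_conv_Cons) auto
  have last: "?d = word [s..<t] * gen t" using assms by simp
  have "?d * word [s..<t] = word (map Suc [s..<t]) * ?d"
    by (rule word_intertwine, rule coxeter_shift) auto
  then have shift: "?d * word [s..<t] = word [Suc s..<Suc t] * ?d"
    by (simp only: map_Suc_upt)
  have "?d * ?d = ?d * (word [s..<t] * gen t)" using last by (rule arg_cong)
  also have "\<dots> = word [Suc s..<Suc t] * ?d * gen t" by (simp only: mult.assoc[symmetric] shift)
  finally have "gen s * ?d ^ 2 = gen s * word [Suc s..<Suc t] * ?d * gen t"
    by (simp only: power2_eq_square mult.assoc)
  also have "\<dots> = ?d ^ 2 * gen t"
    by (simp only: power2_eq_square first[symmetric])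
  finally show ?thesis ..
qed

lemma coxeter_power_shift:
  assumes "s \<le> i" "i + k < t"
  shows "word [s..<t] ^ k * gen i = gen (i + k) * word [s..<t] ^ k"
  using assms(2)
proof (induction k)
  case 0
  then show ?case by simp
next
  case (Suc k)
  let ?d = "word [s..<t]"
  have "?d ^ Suc k * gen i = ?d * (?d ^ k * gen i)" by (simp add: mult.assoc)
  also have "\<dots> = (?d * gen (i + k)) * ?d ^ k" using Suc by (simp add: mult.assoc)
  also have "\<dots> = gen (i + Suc k) * ?d ^ Suc k"
    using Suc.prems assms(1) by (simp add: coxeter_shift mult.assoc)
  finally show ?case .
qed

lemma coxeter_power_wrap:
  assumes "s + p \<le> i" "Suc i < s + p + q"
  shows "word [s..<s + p + q - 1] ^ q * gen i = gen (i - p) * word [s..<s + p + q - 1] ^ q"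
proof -
  \<comment> \<open>The exponent \<open>q\<close> is spent in three stages: \<open>k\<close> shifts
    lift \<open>i\<close> to the top letter \<open>t\<close>, two more factors wrap \<open>t\<close>
    around to \<open>s\<close>, and \<open>l\<close> shifts lift \<open>s\<close> to
    \<open>i - p\<close>.\<close>
  define t k l where "t = s + p + q - 2" and "k = t - i" and "l = i - p - s"
  let ?d = "word [s..<Suc t]"
  have q: "q = l + (2 + k)" and i: "i + k = t" "s + l = i - p" and t: "Suc t = s + p + q - 1"
    using assms unfolding k_def l_def t_def by linarith+
  have 1: "?d ^ k * gen i = gen t * ?d ^ k"
    using coxeter_power_shift[of s i k "Suc t"] assms i by simp
  have 2: "?d ^ 2 * gen t = gen s * ?d ^ 2"
    by (rule coxeter_wrap) (use assms i in linarith)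
  have 3: "?d ^ l * gen s = gen (i - p) * ?d ^ l"
    using coxeter_power_shift[of s s l "Suc t"] i assms by simp
  have "?d ^ q * gen i = ?d ^ l * (?d ^ 2 * (?d ^ k * gen i))"
    by (simp only: q power_add mult.assoc)
  also have "\<dots> = ?d ^ l * (?d ^ 2 * gen t) * ?d ^ k" by (simp only: 1 mult.assoc)
  also have "\<dots> = (?d ^ l * gen s) * ?d ^ 2 * ?d ^ k" by (simp only: 2 mult.assoc)
  also have "\<dots> = gen (i - p) * ?d ^ q" by (simp only: 3 q power_add mult.assoc)
  finally show ?thesis by (simp only: t)
qed

section \<open>Permuting the blocks\<close>

lemma blocks_swap:
  "intertwined (word (u @ blocks s (p # q # c))) (word (u @ blocks s (q # p # c)))"
  if u: "\<forall>i\<in>set u. i + 2 \<le> s"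
proof (cases "p = 0 \<or> q = 0")
  case True
  then have "blocks s (p # q # c) = blocks s (q # p # c)" by auto
  then show ?thesis by (simp only: intertwined_refl)
next
  case False
  let ?d = "[s..<s + p + q - 1]" and ?P = "[s..<s + p - 1]" and ?Q = "[s + p..<s + p + q - 1]"
    and ?v = "blocks (s + p + q) c"
  \<comment> \<open>Conjugation by \<open>?g\<close> moves the first block up by \<open>q\<close>
    strands and wraps the second around to the bottom.\<close>
  let ?g = "word ?d ^ q"
  have P: "?g * word ?P = word [s + q..<s + q + p - 1] * ?g"
  proof -
    have "?g * word ?P = word (map (\<lambda>i. i + q) ?P) * ?g"
      by (rule word_intertwine, rule coxeter_power_shift) auto
    moreover have "map (\<lambda>i. i + q) ?P = [s + q..<s + q + p - 1]"
      by (rule nth_equalityI) (use False in auto)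
    ultimately show ?thesis by simp
  qed
  have Q: "?g * word ?Q = word [s..<s + q - 1] * ?g"
  proof -
    have "?g * word ?Q = word (map (\<lambda>i. i - p) ?Q) * ?g"
      by (rule word_intertwine, rule coxeter_power_wrap) auto
    moreover have "map (\<lambda>i. i - p) ?Q = [s..<s + q - 1]"
      by (rule nth_equalityI) (use False in auto)
    ultimately show ?thesis by simp
  qed
  \<comment> \<open>The letters of \<open>?d\<close> end at \<open>s + p + q - 2\<close>, so the
    letters outside the two blocks are far from all of them.\<close>
  have dcomm: "word ?d * word w = word w * word ?d"
    if "\<forall>i\<in>set w. i + 2 \<le> s \<or> s + p + q \<le> i" for w
    by (rule word_word_far) (use that in force)
  have gcomm: "?g * word w = word w * ?g" if "\<forall>i\<in>set w. i + 2 \<le> s \<or> s + p + q \<le> i" for w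
    using power_commuting_commutes[OF dcomm[OF that]] by simp
  have U: "?g * word u = word u * ?g" by (rule gcomm) (use u in auto)
  have V: "?g * word ?v = word ?v * ?g" by (rule gcomm) (auto dest: blocks_bounds)
  \<comment> \<open>The moved blocks come out in the wrong order; being far apart, they
    commute.\<close>
  have QP: "word [s + q..<s + q + p - 1] * word [s..<s + q - 1] =
      word [s..<s + q - 1] * word [s + q..<s + q + p - 1]"
    by (rule word_word_far) auto
  have "?g * word (u @ blocks s (p # q # c)) = (?g * word u) * (word ?P * (word ?Q * word ?v))"
    by (simp add: mult.assoc)
  also have "\<dots> = word u * ((?g * word ?P) * (word ?Q * word ?v))"
    by (simp only: U mult.assoc)
  also have "\<dots> = word u * (word [s + q..<s + q + p - 1] * ((?g * word ?Q) * word ?v))"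
    by (simp only: P mult.assoc)
  also have "\<dots> = word u * ((word [s + q..<s + q + p - 1] * word [s..<s + q - 1]) * (?g * word ?v))"
    by (simp only: Q mult.assoc)
  also have "\<dots> = word u * ((word [s..<s + q - 1] * word [s + q..<s + q + p - 1]) * (word ?v * ?g))"
    by (simp only: QP V)
  also have "\<dots> = word (u @ blocks s (q # p # c)) * ?g"
    by (simp add: mult.assoc add_ac)
  finally show ?thesis unfolding intertwined_def by blast
qed

text \<open>By induction the tail is rearranged into \<open>d\<close> without \<open>x\<close>,
  after which \<open>x\<close> crosses \<open>d1\<close> by adjacent exchanges. The prefix
  \<open>u\<close> is arbitrary because both inductions push parts into it.\<close>

lemma blocks_permute:
  assumes "mset c = mset d"
  shows "intertwined (word (blocks s (u @ c))) (word (blocks s (u @ d)))"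
  using assms
proof (induction c arbitrary: u d)
  case Nil
  then show ?case by (simp add: intertwined_refl)
next
  case (Cons x c)
  have move: "intertwined (word (blocks s (u @ x # d1 @ d2)))
      (word (blocks s (u @ d1 @ x # d2)))" for u d1 d2
  proof (induction d1 arbitrary: u)
    case Nil
    then show ?case by (simp add: intertwined_refl)
  next
    case (Cons y d1)
    have "intertwined (word (blocks s u @ blocks (s + sum_list u) (x # y # d1 @ d2)))
        (word (blocks s u @ blocks (s + sum_list u) (y # x # d1 @ d2)))"
      by (rule blocks_swap) (auto dest: blocks_bounds)
    then have "intertwined (word (blocks s (u @ x # y # d1 @ d2))) (word (blocks s (u @ y # x # d1 @ d2)))"
      by (simp only: blocks_append)
    moreover have "intertwined (word (blocks s ((u @ [y]) @ x # d1 @ d2))) (word (blocks s ((u @ [y]) @ d1 @ x # d2)))"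
      by (rule Cons.IH)
    ultimately show ?case by (auto intro: intertwined_trans)
  qed
  have "x \<in> set d" using Cons.prems by (metis list.set_intros(1) mset_eq_setD)
  then obtain d1 d2 where d: "d = d1 @ x # d2" by (meson split_list)
  then have "mset c = mset (d1 @ d2)" using Cons.prems by simp
  then have "intertwined (word (blocks s ((u @ [x]) @ c))) (word (blocks s ((u @ [x]) @ d1 @ d2)))"
    by (rule Cons.IH)
  then show ?case using move d by (auto intro: intertwined_trans)
qed

lemma distinct_intertwined_blocks:
  assumes "distinct w"
  shows "\<exists>A. admissible A \<and> intertwined (word w) (word (blocks 0 A))"
proof -
  obtain w' where w': "rotate_commute w w'" "sorted_wrt (<) w'"
    using rotate_commute_sort[OF assms] by blast
  obtain c where c: "w' = blocks 0 c"
    using sorted_eq_blocks[OF w'(2)] by blast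
  define A where "A = rev (sort (filter (\<lambda>a. 2 \<le> a) c))"
  have "admissible A"
    unfolding admissible_def A_def by (auto simp: sorted_wrt_rev)
  \<comment> \<open>Parts below 2 are pushed to the end, where they contribute no letters.\<close>
  moreover have "intertwined (word (blocks 0 ([] @ c))) (word (blocks 0 ([] @ A @ filter (\<lambda>a. \<not> 2 \<le> a) c)))"
    by (rule blocks_permute) (simp add: A_def)
  then have "intertwined (word w') (word (blocks 0 A))"
    by (simp add: c blocks_append blocks_trivial)
  ultimately show ?thesis
    using rotate_commute_intertwined[OF w'(1)] intertwined_trans by blast
qed

section \<open>The underlying permutation\<close>

definition perm :: "nat list \<Rightarrow> nat \<Rightarrow> nat" where
  "perm w = foldr (\<lambda>i f. transpose i (Suc i) \<circ> f) w id"

lemma perm_simps [simp]: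
  "perm [] = id" "perm (i # w) = transpose i (Suc i) \<circ> perm w"
  by (simp_all add: perm_def)

lemma perm_append [simp]: "perm (u @ v) = perm u \<circ> perm v"
  by (induction u) (simp_all add: comp_assoc)

lemma bij_perm: "bij (perm w)"
proof (induction w)
  case (Cons i w)
  then show ?case unfolding perm_simps by (rule bij_comp) (rule bij_transpose)
qed (simp only: perm_simps bij_id)

text \<open>Signs may be dropped because a transposition is its own inverse, and adjacent
  transpositions satisfy the braid relations.\<close>

lemma braid_eq_perm: "(u, v) \<in> braid_eq n \<Longrightarrow> perm (map fst u) = perm (map fst v)"
proof (induction rule: braid_eq.induct)
  case (far i j)
  then show ?case by (auto simp: pos_word_def transpose_def fun_eq_iff)
next
  case (braid i)
  then show ?case by (auto simp: pos_word_def transpose_def fun_eq_iff)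
qed auto

text \<open>Fixed points are left out: a permutation of finite support has infinitely many of them,
  and \<open>mset_set\<close> of an infinite set is empty. The orbits form a set, so each cycle
  counts once.\<close>

definition cycle_type :: "(nat \<Rightarrow> nat) \<Rightarrow> nat multiset" where
  "cycle_type f = image_mset card (mset_set (orbit f ` {i. f i \<noteq> i}))"

lemma orbit_conjugate:
  assumes "g \<circ> h = h \<circ> f"
  shows "orbit g (h i) = h ` orbit f i"
proof -
  have gh: "g (h j) = h (f j)" for j using assms by (metis comp_apply)
  show ?thesis
  proof (intro equalityI subsetI)
    fix j assume "j \<in> orbit g (h i)"
    then show "j \<in> h ` orbit f i"
      by induction (auto simp: gh intro: orbit.intros)
  next
    fix j assume "j \<in> h ` orbit f i"
    then obtain k where "k \<in> orbit f i" "j = h k" by blast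
    from this(1) have "h k \<in> orbit g (h i)"
      by induction (auto simp flip: gh intro: orbit.intros)
    then show "j \<in> orbit g (h i)" using \<open>j = h k\<close> by simp
  qed
qed

text \<open>\<open>h\<close> maps the moved points of \<open>f\<close> onto those of
  \<open>g\<close>, and orbits onto orbits; being injective, it preserves the number and the sizes
  of the orbits.\<close>

lemma cycle_type_conjugate:
  assumes "bij h" "g \<circ> h = h \<circ> f"
  shows "cycle_type g = cycle_type f"
proof -
  have inj: "inj h" and surj: "surj h" using assms(1) by (auto simp: bij_def)
  have gh: "g (h j) = h (f j)" for j using assms(2) by (metis comp_apply)
  have "{i. g i \<noteq> i} = h ` {i. f i \<noteq> i}"
  proof (intro equalityI subsetI)
    fix i assume "i \<in> {i. g i \<noteq> i}"
    moreover obtain j where "i = h j" using surj by blast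
    ultimately show "i \<in> h ` {i. f i \<noteq> i}" using gh by auto
  next
    fix i assume "i \<in> h ` {i. f i \<noteq> i}"
    then show "i \<in> {i. g i \<noteq> i}" using gh inj by (auto dest: injD)
  qed
  then have "orbit g ` {i. g i \<noteq> i} = (`) h ` orbit f ` {i. f i \<noteq> i}"
    by (simp add: image_image orbit_conjugate[OF assms(2)])
  moreover have inj': "inj_on ((`) h) X" for X
    using inj by (simp add: inj_on_def inj_image_eq_iff)
  ultimately have "cycle_type g = image_mset card (image_mset ((`) h) (mset_set (orbit f ` {i. f i \<noteq> i})))"
    unfolding cycle_type_def by (simp only: image_mset_mset_set[OF inj'])
  also have "\<dots> = cycle_type f"
    unfolding cycle_type_def
    by (simp add: image_mset.compositionality comp_def card_image[OF inj_on_subset[OF inj subset_UNIV]])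
  finally show ?thesis .
qed

section \<open>Orbits of a product of blocks\<close>

lemma orbit_cong_on:
  assumes "i \<in> S" "\<And>j. j \<in> S \<Longrightarrow> f j = g j" "\<And>j. j \<in> S \<Longrightarrow> f j \<in> S"
  shows "orbit f i = orbit g i"
proof -
  have "j \<in> orbit g i \<and> j \<in> S" if "j \<in> orbit f i" for j
    using that by induction (metis assms orbit.intros)+
  moreover have "j \<in> orbit f i \<and> j \<in> S" if "j \<in> orbit g i" for j
    using that by induction (metis assms orbit.intros)+
  ultimately show ?thesis by blast
qed

text \<open>This is the cycle through \<open>s\<close>, \<open>s + 1\<close>, ..., \<open>t\<close>;
  the induction splits off its leftmost transposition, which acts last.\<close>

lemma perm_upt:
  assumes "s \<le> t"
  shows "perm [s..<t] i = (if s \<le> i \<and> i < t then Suc i else if i = t then s else i)"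
  using assms
proof (induction "t - s" arbitrary: s)
  case 0
  then show ?case by simp
next
  case (Suc n)
  then have "perm [Suc s..<t] i = (if Suc s \<le> i \<and> i < t then Suc i else if i = t then Suc s else i)"
    by (intro Suc.hyps(1)) auto
  moreover have "[s..<t] = s # [Suc s..<t]" using Suc by (simp add: upt_conv_Cons)
  ultimately show ?case using Suc.hyps(2) by (auto simp: transpose_def)
qed

lemma perm_fixes: "i \<notin> set w \<Longrightarrow> i \<notin> Suc ` set w \<Longrightarrow> perm w i = i"
  by (induction w) (auto simp: transpose_def)

lemma perm_blocks_outside:
  assumes "i < s \<or> s + sum_list c \<le> i"
  shows "perm (blocks s c) i = i"
  by (rule perm_fixes) (use assms in \<open>auto dest!: blocks_bounds\<close>)

lemma orbit_cycle:
  assumes f: "\<And>i. s \<le> i \<Longrightarrow> i < t \<Longrightarrow> f i = Suc i" "f t = s" and "s \<le> i" "i \<le> t"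
  shows "orbit f i = {s..t}"
proof (intro equalityI subsetI)
  fix j assume "j \<in> orbit f i"
  then show "j \<in> {s..t}"
  proof induction
    case base
    then show ?case using assms by (cases "i = t") auto
  next
    case (step j)
    then show ?case using assms by (cases "j = t") auto
  qed
next
  have up: "b \<in> orbit f i" if "a \<in> orbit f i" "s \<le> a" "a \<le> b" "b \<le> t" for a b
    using that(3,1,2,4)
  proof (induction b rule: dec_induct)
    case (step b)
    then have "f b \<in> orbit f i" by (intro orbit.step) auto
    then show ?case using step f by simp
  qed
  \<comment> \<open>Every point climbs to \<open>t\<close> and falls back to \<open>s\<close>, from
    which the whole interval is reached.\<close>
  have s: "s \<in> orbit f i"
  proof (cases "i = t")
    case True
    then show ?thesis using orbit.base[of f i] f by simp
  next
    case False
    then have "Suc i \<in> orbit f i" using orbit.base[of f i] f assms by simp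
    then have "t \<in> orbit f i" by (rule up) (use False assms in auto)
    then show ?thesis using orbit.step[of t f i] f by simp
  qed
  fix j assume "j \<in> {s..t}"
  then show "j \<in> orbit f i" using up[OF s] by auto
qed

text \<open>The first block cycles \<open>s\<close> to \<open>t\<close>, while the later blocks move
  only points from \<open>s + p\<close> on. The supports are disjoint, so one orbit of size
  \<open>p\<close>, nontrivial since \<open>p\<close> is at least 2, joins those of the
  tail.\<close>

lemma cycle_type_blocks:
  assumes "\<forall>a\<in>set A. 2 \<le> a"
  shows "cycle_type (perm (blocks s A)) = mset A"
  using assms
proof (induction A arbitrary: s)
  case Nil
  have "{i. perm (blocks s []) i \<noteq> i} = {}" by simp
  then show ?case unfolding cycle_type_def by (simp only: image_empty mset_set.empty image_mset_empty mset.simps)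
next
  case (Cons p A)
  define f g t where "f = perm (blocks s (p # A))" and "g = perm (blocks (s + p) A)"
    and "t = s + p - 1"
  have p: "2 \<le> p" "s < t" "Suc t = s + p" using Cons.prems by (auto simp: t_def)
  have fg: "f i = perm [s..<t] (g i)" for i by (simp add: f_def g_def t_def)
  have g_low: "g i = i" if "i < s + p" for i
    using that perm_blocks_outside unfolding g_def by blast
  have g_high: "s + p \<le> g i" if "s + p \<le> i" for i
  \<comment> \<open>A value below \<open>s + p\<close> would be a fixed point of \<open>g\<close>,
    hence equal to \<open>i\<close> by injectivity.\<close>
  proof (rule ccontr)
    assume "\<not> s + p \<le> g i"
    then have "g (g i) = g i" by (intro g_low) simp
    then have "g i = i" using bij_perm unfolding g_def by (metis bij_pointE)
    then show False using that \<open>\<not> s + p \<le> g i\<close> by simp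
  qed
  have f_high: "f i = g i" if "s + p \<le> i" for i
    using g_high[OF that] p by (simp add: fg perm_upt)
  have f_low: "f i = (if s \<le> i \<and> i < t then Suc i else if i = t then s else i)" if "i < s + p" for i
    using that p by (simp add: fg g_low perm_upt)
  have orbit_low: "orbit f i = {s..t}" if "s \<le> i" "i \<le> t" for i
    by (rule orbit_cycle) (use f_low p that in auto)
  have orbit_high: "orbit f i = orbit g i" if "s + p \<le> i" for i
    by (rule orbit_cong_on[where S = "{s + p..}"]) (use f_high g_high that in auto)
  have moved: "{i. f i \<noteq> i} = {s..t} \<union> {i. g i \<noteq> i}"
  proof (rule Set.set_eqI)
    fix i
    show "i \<in> {i. f i \<noteq> i} \<longleftrightarrow> i \<in> {s..t} \<union> {i. g i \<noteq> i}"
      using f_high[of i] f_low[of i] g_low[of i] p by (cases "s + p \<le> i") auto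
  qed
  have g_moved: "s + p \<le> i" if "g i \<noteq> i" for i using that g_low by (meson not_le)
  have "orbit f ` {s..t} = {{s..t}}" using orbit_low p by force
  moreover have "orbit f ` {i. g i \<noteq> i} = orbit g ` {i. g i \<noteq> i}"
    using orbit_high g_moved by (intro image_cong) auto
  ultimately have orbits: "orbit f ` {i. f i \<noteq> i} = insert {s..t} (orbit g ` {i. g i \<noteq> i})"
    by (simp add: moved image_Un)
  \<comment> \<open>Finiteness lets \<open>mset_set\<close> of the enlarged orbit set gain exactly
    one element.\<close>
  have "{i. g i \<noteq> i} \<subseteq> {..<s + p + sum_list A}"
  proof
    fix i assume "i \<in> {i. g i \<noteq> i}"
    then have "\<not> s + p + sum_list A \<le> i"
      using perm_blocks_outside[of i "s + p" A] by (auto simp: g_def)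
    then show "i \<in> {..<s + p + sum_list A}" by simp
  qed
  then have fin: "finite (orbit g ` {i. g i \<noteq> i})"
    by (intro finite_imageI) (rule finite_subset, auto)
  have "{s..t} \<noteq> orbit g i" if "g i \<noteq> i" for i
  proof -
    have "s + p \<le> g i" using g_high g_moved that by blast
    then have "g i \<notin> {s..t}" using p by simp
    moreover have "g i \<in> orbit g i" by (rule orbit.base)
    ultimately show ?thesis by blast
  qed
  then have "{s..t} \<notin> orbit g ` {i. g i \<noteq> i}" by blast
  then have "cycle_type f = add_mset (card {s..t}) (cycle_type g)"
    unfolding cycle_type_def orbits using fin by simp
  also have "\<dots> = mset (p # A)" using Cons p by (simp add: g_def)
  finally show ?case by (simp only: f_def)
qed

section \<open>Conjugacy in the braid group\<close>

interpretation braid_inf: word_congruence "\<Union>n\<in>{1..}. braid_words n" braid_eq_inf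
  by (rule word_congruence_braid_inf)

lemma pos_word_inf: "pos_word (map Suc w) \<in> (\<Union>n\<in>{1..}. braid_words n)"
proof (rule UN_I)
  \<comment> \<open>\<open>sum_list w\<close> bounds every letter; one \<open>Suc\<close> is for the
    index shift, the other for the strict bound.\<close>
  show "pos_word (map Suc w) \<in> braid_words (Suc (Suc (sum_list w)))"
    by (auto simp: braid_words_def pos_word_def less_Suc_eq_le member_le_sum_list)
qed simp

lemma pos_word_append [simp]: "pos_word (u @ v) = pos_word u @ pos_word v"
  by (simp add: pos_word_def)

text \<open>This carries equations of the monoid over to the braid group; \<open>Suc\<close>
  restores the numbering of generators from 1.\<close>

lemma artin_eq_braid_eq_inf:
  "artin_eq u v \<Longrightarrow> (pos_word (map Suc u), pos_word (map Suc v)) \<in> braid_eq_inf"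
proof (induction rule: artin_eq.induct)
  case (refl u)
  then show ?case by (intro braid_inf.refl pos_word_inf)
next
  case (sym u v)
  then show ?case using braid_inf.equiv by (meson equiv_def symD)
next
  case (trans u v w)
  then show ?case using braid_inf.equiv by (meson equiv_def transD)
next
  case (append u u' v v')
  then show ?case by (simp add: braid_inf.append)
next
  case (far i j)
  then have "(pos_word [Suc i, Suc j], pos_word [Suc j, Suc i]) \<in> braid_eq (Suc (Suc j))"
    by (intro braid_eq.far) auto
  then show ?case by (auto simp: braid_eq_inf_def)
next
  case (braid i)
  have "(pos_word [Suc i + 1, Suc i, Suc i + 1], pos_word [Suc i, Suc i + 1, Suc i])
      \<in> braid_eq (Suc (Suc (Suc i)))"
    by (intro braid_eq.braid) auto
  then show ?case by (auto simp: braid_eq_inf_def)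
qed

text \<open>Clearing the inverse gives conjugacy the shape of \<open>intertwined\<close>, now with a
  conjugating word that may contain inverse letters.\<close>

lemma conjugate_braid_group_inf_iff:
  assumes u: "u \<in> (\<Union>n\<in>{1..}. braid_words n)" and v: "v \<in> (\<Union>n\<in>{1..}. braid_words n)"
  shows "conjugate_in braid_group_inf (braid_eq_inf `` {u}) (braid_eq_inf `` {v}) \<longleftrightarrow>
    (\<exists>w\<in>\<Union>n\<in>{1..}. braid_words n. (w @ u, v @ w) \<in> braid_eq_inf)"
proof -
  interpret group braid_group_inf by (rule group_braid_group_inf)
  let ?W = "\<Union>n\<in>{1..}. braid_words n" and ?cl = "\<lambda>w. braid_eq_inf `` {w}"
  have car: "?cl w \<in> carrier braid_group_inf" if "w \<in> ?W" for w
    using braid_inf.class_carrier[OF that] by (simp only: braid_group_inf_def)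
  have mult: "?cl a \<otimes>\<^bsub>braid_group_inf\<^esub> ?cl b = ?cl (a @ b)" if "a \<in> ?W" "b \<in> ?W" for a b
    using braid_inf.mult_class[OF that] by (simp only: braid_group_inf_def)
  have iff: "?cl v = ?cl w \<otimes>\<^bsub>braid_group_inf\<^esub> ?cl u \<otimes>\<^bsub>braid_group_inf\<^esub> inv\<^bsub>braid_group_inf\<^esub> ?cl w \<longleftrightarrow>
      (w @ u, v @ w) \<in> braid_eq_inf" if w: "w \<in> ?W" for w
  proof -
    have "?cl v = ?cl w \<otimes>\<^bsub>braid_group_inf\<^esub> ?cl u \<otimes>\<^bsub>braid_group_inf\<^esub> inv\<^bsub>braid_group_inf\<^esub> ?cl w \<longleftrightarrow>
        ?cl w \<otimes>\<^bsub>braid_group_inf\<^esub> ?cl u = ?cl v \<otimes>\<^bsub>braid_group_inf\<^esub> ?cl w"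
      using inv_solve_right[OF car[OF v] m_closed[OF car[OF w] car[OF u]] car[OF w]] .
    also have "\<dots> \<longleftrightarrow> ?cl (w @ u) = ?cl (v @ w)"
      by (simp only: mult[OF w u] mult[OF v w])
    also have "\<dots> \<longleftrightarrow> (w @ u, v @ w) \<in> braid_eq_inf"
      using braid_inf.equiv braid_inf.append_words[OF w u] braid_inf.append_words[OF v w]
      by (rule eq_equiv_class_iff)
    finally show ?thesis .
  qed
  have "carrier braid_group_inf = ?cl ` ?W"
    unfolding braid_group_inf_def word_quotient_def quotient_def by (simp only: monoid.simps partial_object.simps) blast
  then have "conjugate_in braid_group_inf (?cl u) (?cl v) \<longleftrightarrow> (\<exists>w\<in>?W. ?cl v =
      ?cl w \<otimes>\<^bsub>braid_group_inf\<^esub> ?cl u \<otimes>\<^bsub>braid_group_inf\<^esub> inv\<^bsub>braid_group_inf\<^esub> ?cl w)"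
    by (simp only: conjugate_in_def bex_simps)
  also have "\<dots> \<longleftrightarrow> (\<exists>w\<in>?W. (w @ u, v @ w) \<in> braid_eq_inf)"
    by (rule bex_cong[OF HOL.refl]) (rule iff)
  finally show ?thesis .
qed

lemma beta_eq_blocks: "beta A = braid_eq_inf `` {pos_word (blocks 1 A)}"
proof -
  \<comment> \<open>The offset \<open>t\<close> is general because the tail of \<open>p # A\<close>
    starts after \<open>p\<close> strands.\<close>
  have "concat (map (\<lambda>i. pos_word [t + partial_sum A i + 1..<t + partial_sum A (i + 1)]) [0..<length A])
      = pos_word (blocks (Suc t) A)" for t
  proof (induction A arbitrary: t)
    case Nil
    then show ?case by (simp add: pos_word_def)
  next
    case (Cons p A)
    have "[0..<length (p # A)] = 0 # map Suc [0..<length A]"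
      by (simp add: map_Suc_upt upt_conv_Cons del: upt_Suc)
    then have "concat (map (\<lambda>i. pos_word [t + partial_sum (p # A) i + 1..<t + partial_sum (p # A) (i + 1)])
          [0..<length (p # A)])
        = pos_word [Suc t..<t + p] @
          concat (map (\<lambda>i. pos_word [(t + p) + partial_sum A i + 1..<(t + p) + partial_sum A (i + 1)])
            [0..<length A])"
      by (simp add: partial_sum_def comp_def add.assoc del: upt_Suc)
    also have "\<dots> = pos_word (blocks (Suc t) (p # A))" unfolding Cons.IH by simp
    finally show ?case .
  qed
  from this[of 0] show ?thesis by (simp add: beta_def)
qed

theorem theorem1p9:
  shows "(\<forall>\<beta>\<in>simple_braids_inf. \<exists>A. admissible A \<and> conjugate_in braid_group_inf \<beta> (beta A)) \<and>
    (\<forall>A A'. admissible A \<longrightarrow> admissible A' \<longrightarrow>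
       conjugate_in braid_group_inf (beta A) (beta A') \<longrightarrow> A = A')"
proof (intro conjI ballI allI impI)
  fix \<beta> assume "\<beta> \<in> simple_braids_inf"
  then obtain n w where n: "1 \<le> n" and w: "distinct w" "set w \<subseteq> {1..<n}"
    and \<beta>: "\<beta> = braid_incl_inf (braid_eq n `` {pos_word w})"
    by (auto simp: simple_braids_inf_def simple_braids_def)
  have "pos_word w \<in> braid_words n" using w by (auto simp: braid_words_def pos_word_def)
  then have \<beta>': "\<beta> = braid_eq_inf `` {pos_word w}" using \<beta> braid_incl_inf_hom(2)[OF n] by simp
  \<comment> \<open>All letters of \<open>w\<close> are at least 1, so \<open>Suc\<close> undoes the
    subtraction.\<close>
  define w' where "w' = map (\<lambda>i. i - 1) w"
  have Suc_w': "map Suc w' = w"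
    unfolding w'_def map_map by (rule map_idI) (use w in auto)
  then have "distinct w'" using w(1) by (metis distinct_map)
  then obtain A where A: "admissible A" "intertwined (word w') (word (blocks 0 A))"
    using distinct_intertwined_blocks by blast
  \<comment> \<open>Every element of the monoid is the class of a word, so the conjugator becomes a
    positive word.\<close>
  then obtain g where g: "word (g @ w') = word (blocks 0 A @ g)"
    unfolding intertwined_def by (metis obtain_word word_simps(3))
  have "(pos_word (map Suc (g @ w')), pos_word (map Suc (blocks 0 A @ g))) \<in> braid_eq_inf"
    using g by (intro artin_eq_braid_eq_inf) (simp only: word_eq_iff)
  then have "(pos_word (map Suc g) @ pos_word w, pos_word (blocks 1 A) @ pos_word (map Suc g)) \<in> braid_eq_inf"
    by (simp add: Suc_w' map_Suc_blocks)
  then have "conjugate_in braid_group_inf \<beta> (beta A)"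
    unfolding \<beta>' beta_eq_blocks
    using pos_word_inf[of w'] pos_word_inf[of "blocks 0 A"] pos_word_inf[of g]
    by (subst conjugate_braid_group_inf_iff) (auto simp: Suc_w' map_Suc_blocks simp del: UN_iff)
  then show "\<exists>A. admissible A \<and> conjugate_in braid_group_inf \<beta> (beta A)" using A by blast
next
  fix A A' assume A: "admissible A" and A': "admissible A'"
    and conj: "conjugate_in braid_group_inf (beta A) (beta A')"
  have words: "pos_word (blocks 1 c) \<in> (\<Union>n\<in>{1..}. braid_words n)" for c
    using pos_word_inf[of "blocks 0 c"] by (simp add: map_Suc_blocks)
  obtain w where "(w @ pos_word (blocks 1 A), pos_word (blocks 1 A') @ w) \<in> braid_eq_inf"
    using conj unfolding beta_eq_blocks conjugate_braid_group_inf_iff[OF words words] by blast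
  \<comment> \<open>The permutations of the two block words are conjugate by that of
    \<open>w\<close>.\<close>
  then have "perm (map fst (pos_word (blocks 1 A') @ w)) = perm (map fst (w @ pos_word (blocks 1 A)))"
    by (auto simp: braid_eq_inf_def dest: braid_eq_perm)
  then have "perm (blocks 1 A') \<circ> perm (map fst w) = perm (map fst w) \<circ> perm (blocks 1 A)"
    by (simp add: pos_word_def comp_def)
  then have "cycle_type (perm (blocks 1 A')) = cycle_type (perm (blocks 1 A))"
    using bij_perm cycle_type_conjugate by blast
  then have "mset (rev A) = mset (rev A')"
    using A A' by (simp add: cycle_type_blocks admissible_def)
  \<comment> \<open>The reversed sequences are ascending, so their common multiset determines
    them.\<close>
  moreover have "sorted (rev A)" "sorted (rev A')"
    using A A' by (simp_all add: admissible_def sorted_wrt_rev)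
  ultimately have "rev A = rev A'" by (metis properties_for_sort)
  then show "A = A'" by simp
qed

end
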